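(* The relations $\sim_\alpha$ on $\mathcal{K}_1$ for $\alpha\leq\omega_1^{CK}$ are all different. Thus $\mathrm{ord}(\mathcal{K}_1)\geq\omega_1^{CK}$.
   Context: For a pca $\mathcal{A}$ (set with partial application, associating to the left, with combinators $K$, $S$), closed terms are built from elements by application, and $s\simeq t$ means both undefined or both defined and equal. Relations $\sim_\alpha$ on closed terms: $s\sim_0 t$ iff $s\simeq t$; $s \sim_{\alpha+1} t$ iff $sx \sim_\alpha tx$ for all $x\in\mathcal{A}$; for limit $\alpha$, $s\sim_\alpha t$ iff $s\sim_\beta t$ for some $\beta<\alpha$. $\mathrm{ord}(\mathcal{A})$ is the least $\alpha$ with $\sim_\alpha=\sim_{\alpha+1}$. $\mathcal{K}_1$ is the pca on $\omega$ with $n\cdot m=\Phi_n(m)$ ($\Phi_n$ the $n$-th partial computable function). $\omega_1^{CK}$ is the least non-computable ordinal. *)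

theory Defs
  imports "HOL-Library.Countable" "HOL-Library.Countable_Set" "HOL-Library.Nat_Bijection"
begin

text \<open>
  An ordinal is an order type of a well-order on a subset of the natural numbers, so this type
  is (a copy of) the first uncountable ordinal. Countable ordinals suffice for the relations on
  the closed terms of a countable partial applicative structure; see \<open>ex_sim_succ_eq\<close> below.
\<close>

quotient_type ordinal = "nat rel" / partial: "\<lambda>r s. (r, s) \<in> ordIso"
proof (rule part_equivpI)
  have "Well_order ({} :: nat rel)"
    by (simp add: well_order_on_def linear_order_on_def partial_order_on_def preorder_on_def
        refl_on_def trans_def antisym_def total_on_def)
  then show "\<exists>r::nat rel. (r, r) \<in> ordIso"
    using ordIso_reflexive by blast
  show "symp (\<lambda>r s::nat rel. (r, s) \<in> ordIso)"
    by (auto intro!: sympI ordIso_symmetric)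
  show "transp (\<lambda>r s::nat rel. (r, s) \<in> ordIso)"
    by (auto intro!: transpI elim: ordIso_transitive)
qed

definition order_type :: "nat rel \<Rightarrow> ordinal" where
  "order_type r = abs_ordinal r"

instantiation ordinal :: wellorder
begin

lift_definition less_eq_ordinal :: "ordinal \<Rightarrow> ordinal \<Rightarrow> bool" is "\<lambda>r s. (r, s) \<in> ordLeq"
  by (meson ordIso_ordLeq_trans ordIso_symmetric ordLeq_ordIso_trans)

lift_definition less_ordinal :: "ordinal \<Rightarrow> ordinal \<Rightarrow> bool" is "\<lambda>r s. (r, s) \<in> ordLess"
  by (meson ordIso_ordLess_trans ordIso_symmetric ordLess_ordIso_trans)

lemma ordinal_cases:
  obtains r where "Well_order r" "\<alpha> = order_type r"
proof -
  have "(rep_ordinal \<alpha>, rep_ordinal \<alpha>) \<in> ordIso"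
    using Quotient_rep_reflp[OF Quotient_ordinal] by blast
  then have "Well_order (rep_ordinal \<alpha>)"
    by (simp add: ordIso_def)
  moreover have "\<alpha> = order_type (rep_ordinal \<alpha>)"
    by (simp add: order_type_def Quotient_abs_rep[OF Quotient_ordinal])
  ultimately show thesis using that by blast
qed

lemma order_type_eq:
  assumes "Well_order r" "Well_order s"
  shows "order_type r = order_type s \<longleftrightarrow> (r, s) \<in> ordIso"
  unfolding order_type_def
  using assms Quotient_rel[OF Quotient_ordinal] ordIso_reflexive by fastforce

lemma order_type_le:
  assumes "Well_order r" "Well_order s"
  shows "order_type r \<le> order_type s \<longleftrightarrow> (r, s) \<in> ordLeq"
  unfolding order_type_def
  by (rule less_eq_ordinal.abs_eq) (simp_all add: assms ordIso_reflexive)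

lemma order_type_less:
  assumes "Well_order r" "Well_order s"
  shows "order_type r < order_type s \<longleftrightarrow> (r, s) \<in> ordLess"
  unfolding order_type_def
  by (rule less_ordinal.abs_eq) (simp_all add: assms ordIso_reflexive)

instance
proof
  fix \<alpha> \<beta> \<gamma> :: ordinal
  obtain r where r: "Well_order r" "\<alpha> = order_type r" by (rule ordinal_cases)
  obtain s where s: "Well_order s" "\<beta> = order_type s" by (rule ordinal_cases)
  obtain t where t: "Well_order t" "\<gamma> = order_type t" by (rule ordinal_cases)
  show "\<alpha> < \<beta> \<longleftrightarrow> \<alpha> \<le> \<beta> \<and> \<not> \<beta> \<le> \<alpha>"
    using r s by (simp add: order_type_le order_type_less)
      (metis not_ordLeq_iff_ordLess ordLess_imp_ordLeq)
  show "\<alpha> \<le> \<alpha>"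
    using r by (simp add: order_type_le ordLeq_reflexive)
  show "\<alpha> \<le> \<gamma>" if "\<alpha> \<le> \<beta>" "\<beta> \<le> \<gamma>"
    using that r s t by (simp add: order_type_le) (blast intro: ordLeq_transitive)
  show "\<alpha> = \<beta>" if "\<alpha> \<le> \<beta>" "\<beta> \<le> \<alpha>"
    using that r s by (simp add: order_type_le order_type_eq ordIso_iff_ordLeq)
  show "\<alpha> \<le> \<beta> \<or> \<beta> \<le> \<alpha>"
    using r s by (simp add: order_type_le ordLeq_total)
next
  fix P and \<alpha> :: ordinal
  assume step: "\<And>\<alpha>::ordinal. (\<And>\<beta>. \<beta> < \<alpha> \<Longrightarrow> P \<beta>) \<Longrightarrow> P \<alpha>"
  have "Well_order r \<Longrightarrow> P (order_type r)" for r
  proof (induction r rule: wf_induct_rule[OF wf_ordLess])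
    case (1 r)
    show ?case
    proof (rule step)
      fix \<beta> assume less: "\<beta> < order_type r"
      obtain s where "Well_order s" "\<beta> = order_type s" by (rule ordinal_cases)
      with less 1 show "P \<beta>" by (simp add: order_type_less)
    qed
  qed
  then show "P \<alpha>" by (metis ordinal_cases)
qed

end

instantiation ordinal :: zero
begin

definition zero_ordinal :: ordinal where
  "0 = order_type {}"

instance ..

end

definition succ :: "ordinal \<Rightarrow> ordinal" where
  "succ \<alpha> = (LEAST \<beta>. \<alpha> < \<beta>)"

definition limit_ordinal :: "ordinal \<Rightarrow> bool" where
  "limit_ordinal \<alpha> \<longleftrightarrow> \<alpha> \<noteq> 0 \<and> (\<forall>\<beta>. \<alpha> \<noteq> succ \<beta>)"

lemma zero_le_ordinal: "(0::ordinal) \<le> \<alpha>"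
proof -
  obtain r where r: "Well_order r" "\<alpha> = order_type r" by (rule ordinal_cases)
  have wo: "Well_order ({} :: nat rel)"
    by (simp add: well_order_on_def linear_order_on_def partial_order_on_def preorder_on_def
        refl_on_def trans_def antisym_def total_on_def)
  have "({} :: nat rel, r) \<in> ordLeq"
  proof (rule ccontr)
    assume "({} :: nat rel, r) \<notin> ordLeq"
    then have "(r, {} :: nat rel) \<in> ordLess" using not_ordLeq_iff_ordLess[OF r(1) wo] by simp
    then have "\<exists>a\<in>Field ({} :: nat rel). (r, Restr {} (underS {} a)) \<in> ordIso"
      using ordLess_iff_ordIso_Restr[OF wo r(1)] by blast
    then show False by (simp add: Field_def)
  qed
  then show ?thesis using r wo by (simp add: zero_ordinal_def order_type_le)
qed

lemma ex_greater_ordinal: "\<exists>\<beta>. \<alpha> < (\<beta>::ordinal)"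
proof -
  obtain r0 where r0: "Well_order r0" "\<alpha> = order_type r0" by (rule ordinal_cases)
  define r where "r = dir_image r0 Suc"
  have inj: "inj_on Suc (Field r0)" by simp
  have wr: "Well_order r" and iso: "(r0, r) \<in> ordIso"
    using Well_order_dir_image[OF r0(1) inj] dir_image_ordIso[OF r0(1) inj]
    by (simp_all add: r_def)
  have 0: "0 \<notin> Field r"
    by (auto simp: r_def dir_image_def Field_def)
  define s where "s = r \<union> {(x, 0) |x. x \<in> Field r} \<union> {(0, 0)}"
  have Fs: "Field s = insert 0 (Field r)"
    by (auto simp: s_def Field_def)
  have lr: "Linear_order r" using wr by (simp add: well_order_on_def)
  have s_iff: "(x, y) \<in> s \<longleftrightarrow> (x, y) \<in> r \<or> x \<in> Field r \<and> y = 0 \<or> x = 0 \<and> y = 0" for x y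
    by (auto simp: s_def)
  have fld: "x \<in> Field r" "y \<in> Field r" if "(x, y) \<in> r" for x y
    using that by (auto simp: Field_def)
  have "refl_on (Field s) s"
    using lr unfolding Fs linear_order_on_def partial_order_on_def preorder_on_def refl_on_def
    by (auto simp: s_iff dest: fld)
  moreover have "trans s"
  proof (rule transI)
    fix x y z assume "(x, y) \<in> s" "(y, z) \<in> s"
    moreover have "trans r"
      using lr by (simp add: linear_order_on_def partial_order_on_def preorder_on_def)
    ultimately show "(x, z) \<in> s" unfolding s_iff using 0 fld by (meson transD)
  qed
  moreover have "antisym s"
  proof (rule antisymI)
    fix x y assume "(x, y) \<in> s" "(y, x) \<in> s"
    moreover have "antisym r"
      using lr by (simp add: linear_order_on_def partial_order_on_def)
    ultimately show "x = y" unfolding s_iff using 0 fld by (meson antisymD)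
  qed
  moreover have "total_on (Field s) s"
    using lr unfolding Fs linear_order_on_def total_on_def s_iff by auto
  moreover have "s \<subseteq> Field s \<times> Field s"
    by (auto simp: Field_def)
  ultimately have ls: "Linear_order s"
    by (simp add: linear_order_on_def partial_order_on_def preorder_on_def)
  have "wf (s - Id)"
  proof (rule wfI_min)
    fix x and Q :: "nat set" assume x: "x \<in> Q"
    show "\<exists>z\<in>Q. \<forall>y. (y, z) \<in> s - Id \<longrightarrow> y \<notin> Q"
    proof (cases "Q \<inter> Field r = {}")
      case True
      then have "(y, x) \<in> s - Id \<Longrightarrow> y \<notin> Q" for y
        using x fld unfolding s_iff Diff_iff by blast
      then show ?thesis using x by blast
    next
      case False
      have "wf (r - Id)" using wr by (simp add: well_order_on_def)
      then obtain z where z: "z \<in> Q \<inter> Field r" "\<And>y. (y, z) \<in> r - Id \<Longrightarrow> y \<notin> Q \<inter> Field r"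
        using False by (metis wfE_min')
      show ?thesis
      proof (intro bexI[of _ z] allI impI)
        fix y assume "(y, z) \<in> s - Id"
        then have "(y, z) \<in> r - Id" using z(1) 0 unfolding s_iff Diff_iff by blast
        then show "y \<notin> Q" using z(2)[of y] fld by blast
      qed (use z in blast)
    qed
  qed
  then have ws: "Well_order s" using ls by (simp add: well_order_on_def)
  have u: "underS s 0 = Field r"
    using 0 fld by (auto simp: underS_def s_iff intro!: gr0I)
  have "Restr s (underS s 0) = r"
    unfolding u using 0 fld by (auto simp: s_iff)
  then have "(r, s) \<in> ordLess"
    using underS_Restr_ordLess[OF ws, of 0] Fs by auto
  then have "order_type r < order_type s"
    using wr ws by (simp add: order_type_less)
  moreover have "\<alpha> = order_type r" using r0 wr iso by (simp add: order_type_eq)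
  ultimately show ?thesis by auto
qed

lemma less_succ: "\<alpha> < succ \<alpha>"
  unfolding succ_def using ex_greater_ordinal by (metis LeastI)

lemma succ_le_iff: "succ \<alpha> \<le> \<beta> \<longleftrightarrow> \<alpha> < \<beta>"
  by (metis Least_le less_succ order_less_le_trans succ_def)

lemma succ_inject [simp]: "succ \<alpha> = succ \<beta> \<longleftrightarrow> \<alpha> = \<beta>"
  by (metis less_succ linorder_less_linear not_less succ_le_iff)

lemma succ_not_zero [simp]: "succ \<alpha> \<noteq> 0" "0 \<noteq> succ \<alpha>"
  using less_succ[of \<alpha>] zero_le_ordinal[of \<alpha>] by auto

lemma less_order_type_iff:
  assumes "Well_order s"
  shows "\<gamma> < order_type s \<longleftrightarrow> (\<exists>a\<in>Field s. \<gamma> = order_type (Restr s (underS s a)))"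
proof -
  obtain r where r: "Well_order r" "\<gamma> = order_type r" by (rule ordinal_cases)
  have "order_type r = order_type (Restr s (underS s a)) \<longleftrightarrow> (r, Restr s (underS s a)) \<in> ordIso" for a
    by (rule order_type_eq[OF r(1) Well_order_Restr[OF assms]])
  then show ?thesis
    unfolding r(2) by (simp add: order_type_less[OF r(1) assms] ordLess_iff_ordIso_Restr[OF assms r(1)])
qed

lemma uncountable_ordinal: "\<not> inj (f :: ordinal \<Rightarrow> nat)"
proof
  assume inj: "inj f"
  define R where "R = {(f \<alpha>, f \<beta>) |\<alpha> \<beta>. \<alpha> \<le> \<beta>}"
  define Q where "Q \<alpha> = Restr R (underS R (f \<alpha>))" for \<alpha>
  have R_iff: "(f \<alpha>, f \<beta>) \<in> R \<longleftrightarrow> \<alpha> \<le> \<beta>" for \<alpha> \<beta>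
    using inj by (auto simp: R_def dest: injD)
  have FR: "Field R = range f"
    unfolding Field_def R_def by auto
  have "refl_on (Field R) R"
    unfolding FR refl_on_def by (auto simp: R_def)
  moreover have "trans R"
    unfolding R_def by (rule transI) (use inj in \<open>fastforce dest: injD\<close>)
  moreover have "antisym R"
    by (auto simp: R_def inj_eq[OF inj] intro!: antisymI)
  moreover have "total_on (Field R) R"
    unfolding FR total_on_def by (auto simp: R_iff)
  moreover have "R \<subseteq> Field R \<times> Field R"
    by (auto simp: Field_def)
  moreover have "wf (R - Id)"
  proof (rule wf_subset[OF wf_inv_image])
    show "wf {(\<alpha>::ordinal, \<beta>). \<alpha> < \<beta>}" by (rule wf)
    show "R - Id \<subseteq> inv_image {(\<alpha>, \<beta>). \<alpha> < \<beta>} (inv f)"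
      using inj by (auto simp: R_def order_le_less)
  qed
  ultimately have wR: "Well_order R"
    by (simp add: well_order_on_def linear_order_on_def partial_order_on_def preorder_on_def)
  have u: "underS R (f \<alpha>) = f ` {..<\<alpha>}" for \<alpha>
  proof
    show "underS R (f \<alpha>) \<subseteq> f ` {..<\<alpha>}"
    proof
      fix x assume x: "x \<in> underS R (f \<alpha>)"
      then have "x \<in> Field R" by (auto simp: underS_def Field_def)
      then obtain \<beta> where "x = f \<beta>" using FR by blast
      with x show "x \<in> f ` {..<\<alpha>}" by (auto simp: underS_def R_iff order_le_less)
    qed
    show "f ` {..<\<alpha>} \<subseteq> underS R (f \<alpha>)"
      using inj by (auto simp: underS_def R_iff dest: injD)
  qed
  have wQ: "Well_order (Q \<alpha>)" for \<alpha>
    unfolding Q_def by (rule Well_order_Restr[OF wR])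
  have FQ: "Field (Q \<alpha>) = f ` {..<\<alpha>}" for \<alpha>
    unfolding Q_def u
    using well_order_on_Well_order[OF well_order_on_Restr[OF wR, of "f ` {..<\<alpha>}"]] FR by auto
  have uR: "underS (Restr R A) b = underS R b \<inter> A" if "b \<in> A" for A b
    using that by (auto simp: underS_def)
  have uQ: "Restr (Q \<alpha>) (underS (Q \<alpha>) (f \<beta>)) = Q \<beta>" if "\<beta> < \<alpha>" for \<alpha> \<beta>
  proof -
    have sub: "f ` {..<\<beta>} \<subseteq> f ` {..<\<alpha>}"
      using that by (intro image_mono) auto
    have "underS (Q \<alpha>) (f \<beta>) = f ` {..<\<beta>}"
      unfolding Q_def u using uR[of "f \<beta>" "f ` {..<\<alpha>}"] that sub u[of \<beta>] by auto
    then show ?thesis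
      unfolding Q_def u using sub by blast
  qed
  have Q: "order_type (Q \<alpha>) = \<alpha>" for \<alpha>
  proof (induction \<alpha> rule: less_induct)
    case (less \<alpha>)
    have "\<gamma> < order_type (Q \<alpha>) \<longleftrightarrow> \<gamma> < \<alpha>" for \<gamma>
      using less by (auto simp: less_order_type_iff[OF wQ] FQ uQ)
    then show ?case by (metis linorder_neq_iff order_less_irrefl)
  qed
  have "\<gamma> < order_type R" for \<gamma>
    unfolding less_order_type_iff[OF wR] FR using Q[of \<gamma>] unfolding Q_def by (metis rangeI)
  then show False by blast
qed

text \<open>
  A partial application on a type is an option-valued binary function, \<open>None\<close> meaning
  undefined. The combinators of a partial combinatory algebra do not enter into the
  definitions below, so no axioms on the application are imposed here.
\<close>

type_synonym 'a partial_app = "'a \<Rightarrow> 'a \<Rightarrow> 'a option"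

datatype 'a cterm = Elem 'a | App "'a cterm" "'a cterm"

instance cterm :: (countable) countable
  by countable_datatype

primrec val :: "'a partial_app \<Rightarrow> 'a cterm \<Rightarrow> 'a option" where
  "val app (Elem a) = Some a"
| "val app (App s t) =
     Option.bind (val app s) (\<lambda>a. Option.bind (val app t) (\<lambda>b. app a b))"

text \<open>
  In the first rule, equality of options is Kleene equality. That the rules amount to the
  recursive clauses for zero, successors and limits is \<open>sim_0_iff\<close>, \<open>sim_succ_iff\<close> and
  \<open>sim_limit_iff\<close>.
\<close>

inductive sim :: "'a partial_app \<Rightarrow> ordinal \<Rightarrow> 'a cterm \<Rightarrow> 'a cterm \<Rightarrow> bool"
  for app :: "'a partial_app" where
  sim_0: "val app s = val app t \<Longrightarrow> sim app 0 s t"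
| sim_succ: "(\<And>x. sim app \<alpha> (App s (Elem x)) (App t (Elem x))) \<Longrightarrow> sim app (succ \<alpha>) s t"
| sim_limit: "limit_ordinal \<alpha> \<Longrightarrow> \<beta> < \<alpha> \<Longrightarrow> sim app \<beta> s t \<Longrightarrow> sim app \<alpha> s t"

lemma sim_0_iff: "sim app 0 s t \<longleftrightarrow> val app s = val app t"
  by (auto intro: sim_0 elim: sim.cases simp: limit_ordinal_def)

lemma sim_succ_iff:
  "sim app (succ \<alpha>) s t \<longleftrightarrow> (\<forall>x. sim app \<alpha> (App s (Elem x)) (App t (Elem x)))"
  by (auto intro: sim_succ elim: sim.cases simp: limit_ordinal_def)

lemma sim_limit_iff:
  "limit_ordinal \<alpha> \<Longrightarrow> sim app \<alpha> s t \<longleftrightarrow> (\<exists>\<beta><\<alpha>. sim app \<beta> s t)"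
  by (auto intro: sim_limit elim: sim.cases simp: limit_ordinal_def)

lemma sim_imp_sim_succ: "sim app \<alpha> s t \<Longrightarrow> sim app (succ \<alpha>) s t"
proof (induction rule: sim.induct)
  case (sim_limit \<alpha> \<beta> s t)
  then show ?case by (metis sim.sim_limit sim_succ_iff)
qed (auto simp: sim_succ_iff sim_0_iff)

lemma sim_mono: "\<alpha> \<le> \<beta> \<Longrightarrow> sim app \<alpha> s t \<Longrightarrow> sim app \<beta> s t"
proof (induction \<beta> arbitrary: s t rule: less_induct)
  case (less \<beta>)
  show ?case
  proof (cases "\<alpha> = \<beta>")
    case False
    then have lt: "\<alpha> < \<beta>" using less.prems by simp
    consider \<gamma> where "\<beta> = succ \<gamma>" | "limit_ordinal \<beta>"
      using lt zero_le_ordinal[of \<alpha>] unfolding limit_ordinal_def by (metis leD)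
    then show ?thesis
    proof cases
      case 1
      then have "\<alpha> \<le> \<gamma>" "\<gamma> < \<beta>" using lt less_succ by (metis not_le succ_le_iff, simp)
      then show ?thesis using less 1 sim_imp_sim_succ by blast
    qed (use lt less.prems sim_limit in blast)
  qed (use less.prems in simp)
qed

lemma ex_sim_succ_eq:
  fixes app :: "'a::countable partial_app"
  shows "\<exists>\<alpha>. sim app \<alpha> = sim app (succ \<alpha>)"
proof (rule ccontr)
  assume "\<nexists>\<alpha>. sim app \<alpha> = sim app (succ \<alpha>)"
  then have ne: "sim app \<alpha> \<noteq> sim app (succ \<alpha>)" for \<alpha>
    by blast
  have "\<exists>s t. sim app (succ \<alpha>) s t \<and> \<not> sim app \<alpha> s t" for \<alpha>
  proof (rule ccontr)
    assume "\<not> ?thesis"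
    then have "sim app \<alpha> = sim app (succ \<alpha>)"
      by (intro ext) (blast intro: sim_imp_sim_succ)
    with ne show False by blast
  qed
  then have "\<exists>p. sim app (succ \<alpha>) (fst p) (snd p) \<and> \<not> sim app \<alpha> (fst p) (snd p)" for \<alpha>
    by simp
  then obtain p where p: "\<And>\<alpha>. sim app (succ \<alpha>) (fst (p \<alpha>)) (snd (p \<alpha>))"
    "\<And>\<alpha>. \<not> sim app \<alpha> (fst (p \<alpha>)) (snd (p \<alpha>))"
    by metis
  have "p \<alpha> \<noteq> p \<beta>" if "\<alpha> < \<beta>" for \<alpha> \<beta>
    using that p(1)[of \<alpha>] p(2)[of \<beta>] sim_mono succ_le_iff by metis
  then have "inj p" by (metis injI linorder_neq_iff)
  then have "inj (to_nat \<circ> p)" by (simp add: inj_compose)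
  then show False using uncountable_ordinal by blast
qed

text \<open>
  The restriction to countable types guarantees that the least ordinal exists in the type
  \<open>ordinal\<close>; see \<open>ex_sim_succ_eq\<close>.
\<close>

definition pca_ord :: "'a::countable partial_app \<Rightarrow> ordinal" where
  "pca_ord app = (LEAST \<alpha>. sim app \<alpha> = sim app (succ \<alpha>))"

text \<open>
  Unary partial computable functions, with several arguments passed through the Cantor pairing
  function. \<open>Prec\<close> is primitive recursion with a parameter, \<open>Mu\<close> is unbounded minimization.
\<close>

datatype code =
    Zero | Successor | Left | Right
  | Pair code code | Comp code code | Prec code code | Mu code

instance code :: countable
  by countable_datatype

primrec eval :: "code \<Rightarrow> nat \<Rightarrow> nat option" where
  "eval Zero n = Some 0"
| "eval Successor n = Some (Suc n)"
| "eval Left n = Some (fst (prod_decode n))"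
| "eval Right n = Some (snd (prod_decode n))"
| "eval (Pair f g) n =
     Option.bind (eval f n) (\<lambda>a. Option.bind (eval g n) (\<lambda>b. Some (prod_encode (a, b))))"
| "eval (Comp f g) n = Option.bind (eval g n) (\<lambda>a. eval f a)"
| "eval (Prec f g) n =
     (let (a, k) = prod_decode n in
      rec_nat (eval f a)
        (\<lambda>i r. Option.bind r (\<lambda>v. eval g (prod_encode (a, prod_encode (i, v))))) k)"
| "eval (Mu f) n =
     (if \<exists>k. eval f (prod_encode (n, k)) = Some 0 \<and>
             (\<forall>i<k. eval f (prod_encode (n, i)) \<noteq> None)
      then Some (LEAST k. eval f (prod_encode (n, k)) = Some 0)
      else None)"

lemma prod_decode_le: "fst (prod_decode n) \<le> n" "snd (prod_decode n) \<le> n"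
  by (metis le_prod_encode_1 prod.collapse prod_decode_inverse)
     (metis le_prod_encode_2 prod.collapse prod_decode_inverse)

text \<open>
  The Goedel numbering: the four basic functions have the numbers 0 to 3, and the numbers of
  compound codes are obtained by pairing, the remainder modulo 4 selecting the constructor.
\<close>

function decode :: "nat \<Rightarrow> code" where
  "decode n =
     (if n = 0 then Zero else if n = 1 then Successor
      else if n = 2 then Left else if n = 3 then Right
      else let m = (n - 4) div 4;
               f = decode (fst (prod_decode m));
               g = decode (snd (prod_decode m));
               h = decode m
           in if (n - 4) mod 4 = 0 then Pair f g
              else if (n - 4) mod 4 = 1 then Comp f g
              else if (n - 4) mod 4 = 2 then Prec f g
              else Mu h)"
  by auto
termination
proof (relation "measure id")
  fix n m :: nat
  assume "n \<noteq> 0" "m = (n - 4) div 4"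
  then have "m < n" by simp
  then show "(fst (prod_decode m), n) \<in> measure id" "(snd (prod_decode m), n) \<in> measure id"
    "(m, n) \<in> measure id"
    using prod_decode_le[of m] by auto
qed auto

declare decode.simps [simp del]

lemma surj_decode: "\<exists>n. decode n = c"
proof -
  have mod: "(4 * m + k) mod 4 = k" "(4 * m + k) div 4 = m" if "k < 4" for m k :: nat
    using that by auto
  have *: "decode (4 + (4 * prod_encode (a, b) + k)) =
      (if k = 0 then Pair (decode a) (decode b) else if k = 1 then Comp (decode a) (decode b)
       else if k = 2 then Prec (decode a) (decode b) else Mu (decode (prod_encode (a, b))))"
    if "k < 4" for a b k
    by (subst decode.simps) (simp only: mod[OF that] Let_def diff_add_inverse, simp)
  show ?thesis
  proof (induction c)
    case Zero show ?case by (rule exI[of _ 0]) (simp add: decode.simps)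
  next
    case Successor show ?case by (rule exI[of _ 1]) (simp add: decode.simps)
  next
    case Left show ?case by (rule exI[of _ 2]) (simp add: decode.simps)
  next
    case Right show ?case by (rule exI[of _ 3]) (simp add: decode.simps)
  next
    case (Pair f g) then show ?case using *[of 0] by fastforce
  next
    case (Comp f g) then show ?case using *[of 1] by fastforce
  next
    case (Prec f g) then show ?case using *[of 2] by fastforce
  next
    case (Mu f)
    then obtain n where n: "decode n = f" by blast
    obtain a b where "n = prod_encode (a, b)" by (metis prod_decode_inverse surj_pair)
    with *[of 3 a b] n show ?case by auto
  qed
qed

definition \<K>\<^sub>1 :: "nat partial_app" where
  "\<K>\<^sub>1 n m = eval (decode n) m"

text \<open>
  An ordinal is computable if it is the order type of a well-order on a set of natural numbers
  whose order relation is decidable. Well-orders are reflexive here, so their fields are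
  decidable as well.
\<close>

definition computable_rel :: "nat rel \<Rightarrow> bool" where
  "computable_rel r \<longleftrightarrow>
     (\<exists>c. \<forall>x y. eval c (prod_encode (x, y)) = Some (if (x, y) \<in> r then 1 else 0))"

definition computable_ordinal :: "ordinal \<Rightarrow> bool" where
  "computable_ordinal \<alpha> \<longleftrightarrow>
     (\<exists>r. Well_order r \<and> computable_rel r \<and> order_type r = \<alpha>)"

lemma ex_not_computable_ordinal: "\<exists>\<alpha>. \<not> computable_ordinal \<alpha>"
proof (rule ccontr)
  define decides where
    "decides c r \<longleftrightarrow> (\<forall>x y. eval c (prod_encode (x, y)) = Some (if (x, y) \<in> r then 1 else 0))"
    for c and r :: "nat rel"
  have unique: "r = s" if "decides c r" "decides c s" for c r s
  proof -
    have "(x, y) \<in> r \<longleftrightarrow> (x, y) \<in> s" for x y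
    proof -
      have "(if (x, y) \<in> r then 1 else 0 :: nat) = (if (x, y) \<in> s then 1 else 0)"
        using that by (simp add: decides_def)
      then show ?thesis by (cases "(x, y) \<in> r"; cases "(x, y) \<in> s"; simp)
    qed
    then show ?thesis by auto
  qed
  assume "\<nexists>\<alpha>. \<not> computable_ordinal \<alpha>"
  then have "\<exists>c r. decides c r \<and> order_type r = \<alpha>" for \<alpha>
    unfolding computable_ordinal_def computable_rel_def decides_def by blast
  then obtain c r where cr: "\<And>\<alpha>. decides (c \<alpha>) (r \<alpha>)" "\<And>\<alpha>. order_type (r \<alpha>) = \<alpha>"
    by metis
  have "inj c"
  proof (rule injI)
    fix \<alpha> \<beta> assume "c \<alpha> = c \<beta>"
    then have "r \<alpha> = r \<beta>" using unique[OF cr(1)[of \<alpha>]] cr(1)[of \<beta>] by simp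
    then show "\<alpha> = \<beta>" using cr(2) by metis
  qed
  then have "inj (to_nat \<circ> c)" by (simp add: inj_compose)
  then show False using uncountable_ordinal by blast
qed

definition \<omega>\<^sub>1_CK :: ordinal where
  "\<omega>\<^sub>1_CK = (LEAST \<alpha>. \<not> computable_ordinal \<alpha>)"

end

(* Call the rank of (s, t) the least \<alpha> with s \<sim>\<^sub>\<alpha> t.  If s and t have different values and
   (s x, t x) has the rank \<rho> x, then the rank of (s, t) is the successor of the supremum of the \<rho> x.
   For a decidable well-order r, the s-m-n theorem and self-reference yield numbers f b a
   (for b = 0, 1) with f b a \<cdot> x = f b x if x is below a, and f b a \<cdot> x = 0 otherwise.  By induction
   along r, the rank of (f 0 a, f 1 a) is the successor of the order type of the elements below a.
   The two functions (b = 0, 1) with x \<mapsto> f b x on the field of r and 0 elsewhere have the rank succ \<alpha>, where \<alpha> is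
   the order type of r; so \<sim>\<^sub>\<alpha> and \<sim>\<^bsub>\<alpha>+1\<^esub> differ for every computable \<alpha>. *)

theory Submission
  imports Defs
begin

section \<open>Total computable functions\<close>

definition computable :: "(nat \<Rightarrow> nat) \<Rightarrow> bool" where
  "computable f \<longleftrightarrow> (\<exists>c. \<forall>n. eval c n = Some (f n))"

abbreviation pfst :: "nat \<Rightarrow> nat" where "pfst n \<equiv> fst (prod_decode n)"
abbreviation psnd :: "nat \<Rightarrow> nat" where "psnd n \<equiv> snd (prod_decode n)"

lemma computable_comp:
  assumes "computable f" "computable g"
  shows "computable (\<lambda>n. f (g n))"
proof -
  obtain c d where "\<forall>n. eval c n = Some (f n)" "\<forall>n. eval d n = Some (g n)"
    using assms computable_def by auto
  then show ?thesis unfolding computable_def by (intro exI[of _ "Comp c d"]) simp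
qed

lemma computable_prod_encode:
  assumes "computable f" "computable g"
  shows "computable (\<lambda>n. prod_encode (f n, g n))"
proof -
  obtain c d where "\<forall>n. eval c n = Some (f n)" "\<forall>n. eval d n = Some (g n)"
    using assms computable_def by auto
  then show ?thesis unfolding computable_def by (intro exI[of _ "Pair c d"]) simp
qed

lemma computable_Suc: "computable f \<Longrightarrow> computable (\<lambda>n. Suc (f n))"
  by (rule computable_comp[of Suc]) (auto simp: computable_def intro: exI[of _ Successor])

lemma computable_pfst: "computable f \<Longrightarrow> computable (\<lambda>n. pfst (f n))"
  by (rule computable_comp[of pfst]) (auto simp: computable_def intro: exI[of _ Left])

lemma computable_psnd: "computable f \<Longrightarrow> computable (\<lambda>n. psnd (f n))"
  by (rule computable_comp[of psnd]) (auto simp: computable_def intro: exI[of _ Right])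

lemma computable_id: "computable (\<lambda>n. n)"
  unfolding computable_def by (rule exI[of _ "Pair Left Right"]) simp

lemma computable_const: "computable (\<lambda>n. k)"
  by (induction k) (auto intro: computable_Suc simp: computable_def[of "\<lambda>n. 0"] exI[of _ Zero])

text \<open>\<open>Prec\<close> reads its parameter and count from one pair; precomposing with the
  pair of \<open>a n\<close> and \<open>k n\<close> lets both depend on \<open>n\<close>.\<close>

lemma computable_rec_nat:
  assumes "computable f" "computable g" "computable a" "computable k"
  shows "computable (\<lambda>n. rec_nat (f (a n))
    (\<lambda>i v. g (prod_encode (a n, prod_encode (i, v)))) (k n))"
proof -
  obtain c d where c: "\<forall>n. eval c n = Some (f n)" and d: "\<forall>n. eval d n = Some (g n)"
    using assms computable_def by auto
  have rec: "rec_nat (Some x) (\<lambda>i r. Option.bind r (\<lambda>v. Some (h i v))) m = Some (rec_nat x h m)"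
    for x m :: nat and h
    by (induction m) auto
  have "computable (\<lambda>n. rec_nat (f (pfst n))
      (\<lambda>i v. g (prod_encode (pfst n, prod_encode (i, v)))) (psnd n))"
    unfolding computable_def
    by (rule exI[of _ "Prec c d"]) (simp add: c d rec split_beta)
  from computable_comp[OF this computable_prod_encode[OF assms(3,4)]] show ?thesis by simp
qed

text \<open>Branching is a recursion of length \<open>q n\<close> that starts at \<open>f n\<close>
  and whose every step discards the previous value and returns \<open>g n\<close>.\<close>

lemma computable_if:
  assumes "computable q" "computable f" "computable g"
  shows "computable (\<lambda>n. if q n = 0 then f n else g n)"
proof -
  have "(if q n = 0 then f n else g n) =
      rec_nat (f n) (\<lambda>i v. g (pfst (prod_encode (n, prod_encode (i, v))))) (q n)" for n
    by (cases "q n") auto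
  moreover have "computable (\<lambda>m. g (pfst m))"
    using assms(3) computable_pfst[OF computable_id] by (rule computable_comp)
  ultimately show ?thesis
    using computable_rec_nat[OF assms(2) _ computable_id assms(1), of "\<lambda>m. g (pfst m)"] by simp
qed

lemma computable_mult4:
  assumes "computable f"
  shows "computable (\<lambda>n. 4 * f n)"
proof -
  have "4 * m = rec_nat 0 (\<lambda>i v. Suc (Suc (Suc (Suc v)))) m" for m
    by (induction m) auto
  moreover have "computable (\<lambda>m. Suc (Suc (Suc (Suc (psnd (psnd m))))))"
    by (intro computable_Suc computable_psnd computable_id)
  ultimately show ?thesis
    using computable_rec_nat[OF computable_const[of 0] _ computable_id assms,
        of "\<lambda>m. Suc (Suc (Suc (Suc (psnd (psnd m)))))"] by simp
qed

section \<open>The s-m-n theorem\<close>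

text \<open>Inverts \<open>decode\<close>: four successors skip the basic functions, and remainder 0
  modulo 4 selects \<open>Pair\<close>. One more successor, in \<open>comp_num\<close>, selects
  \<open>Comp\<close>.\<close>

definition pair_num :: "nat \<Rightarrow> nat \<Rightarrow> nat" where
  "pair_num a b = Suc (Suc (Suc (Suc (4 * prod_encode (a, b)))))"

definition comp_num :: "nat \<Rightarrow> nat \<Rightarrow> nat" where
  "comp_num a b = Suc (pair_num a b)"

text \<open>Numbers a code of a constant function: \<open>Successor\<close>, with number 1, composed
  repeatedly onto \<open>Zero\<close>, with number 0.\<close>

primrec const_num :: "nat \<Rightarrow> nat" where
  "const_num 0 = 0"
| "const_num (Suc y) = comp_num 1 (const_num y)"

(* pair_num 2 3 is the number of the identity function Pair Left Right. *)
definition smn :: "nat \<Rightarrow> nat \<Rightarrow> nat" where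
  "smn e y = comp_num e (pair_num (const_num y) (pair_num 2 3))"

lemma decode_pair_num: "decode (pair_num a b) = Pair (decode a) (decode b)"
  by (subst decode.simps) (simp add: pair_num_def Let_def)

lemma decode_comp_num: "decode (comp_num a b) = Comp (decode a) (decode b)"
proof -
  have "(1 + 4 * m) mod 4 = 1" "(1 + 4 * m) div 4 = m" for m :: nat
    by presburger+
  then show ?thesis
    by (subst decode.simps) (simp add: comp_num_def pair_num_def Let_def)
qed

lemma eval_const_num: "eval (decode (const_num y)) n = Some y"
  by (induction y) (simp_all add: decode_comp_num decode.simps[of 0] decode.simps[of "Suc 0"])

lemma eval_smn: "eval (decode (smn e y)) x = eval (decode e) (prod_encode (y, x))"
  by (simp add: smn_def decode_comp_num decode_pair_num eval_const_num
      decode.simps[of 2] decode.simps[of 3])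

text \<open>The number \<open>smn e y\<close> contains a code of the constant \<open>y\<close>, and
  evaluating that code recovers \<open>y\<close>. This separates indices even of functions with
  equal values.\<close>

lemma inj_smn: "smn e y = smn e' y' \<Longrightarrow> y = y'"
  unfolding smn_def comp_num_def pair_num_def
  using eval_const_num by (simp add: prod_encode_eq) (metis option.inject)

lemma computable_comp_num:
  "computable f \<Longrightarrow> computable g \<Longrightarrow> computable (\<lambda>n. comp_num (f n) (g n))"
  unfolding comp_num_def pair_num_def
  by (intro computable_Suc computable_mult4 computable_prod_encode)

lemma computable_const_num:
  assumes "computable f"
  shows "computable (\<lambda>n. const_num (f n))"
proof -
  have "const_num m = rec_nat 0 (\<lambda>i v. comp_num 1 v) m" for m
    by (induction m) auto
  moreover have "computable (\<lambda>m. comp_num 1 (psnd (psnd m)))"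
    by (intro computable_comp_num computable_const computable_psnd computable_id)
  ultimately show ?thesis
    using computable_rec_nat[OF computable_const[of 0] _ computable_id assms,
        of "\<lambda>m. comp_num 1 (psnd (psnd m))"] by simp
qed

lemma computable_smn:
  "computable f \<Longrightarrow> computable g \<Longrightarrow> computable (\<lambda>n. smn (f n) (g n))"
  unfolding smn_def pair_num_def
  by (intro computable_comp_num computable_Suc computable_mult4 computable_prod_encode
      computable_const_num computable_const)

lemma computable_index:
  assumes "computable (\<lambda>n. h (pfst n) (psnd n))"
  obtains e where "\<And>y x. \<K>\<^sub>1 (smn e y) x = Some (h y x)"
proof -
  obtain c where "\<forall>n. eval c n = Some (h (pfst n) (psnd n))"
    using assms computable_def by auto
  moreover obtain e where "decode e = c" using surj_decode by blast
  ultimately show thesis using that[of e] by (simp add: \<K>\<^sub>1_def eval_smn)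
qed

section \<open>Decidable relations and self-referential families\<close>

lemma computable_rel_if:
  assumes "computable_rel r" "computable u" "computable v" "computable f" "computable g"
  shows "computable (\<lambda>n. if (u n, v n) \<in> r then f n else g n)"
proof -
  obtain c where c: "\<forall>x y. eval c (prod_encode (x, y)) = Some (if (x, y) \<in> r then 1 else 0)"
    using assms(1) computable_rel_def by blast
  have "\<forall>n. eval c n = Some (if (pfst n, psnd n) \<in> r then 1 else 0)"
    using c by (metis prod.collapse prod_decode_inverse)
  then have "computable (\<lambda>n. if (pfst n, psnd n) \<in> r then 1 else 0)"
    unfolding computable_def by blast
  from computable_comp[OF this computable_prod_encode[OF assms(2,3)]]
  have "computable (\<lambda>n. if (u n, v n) \<in> r then 1 else 0)" by simp
  \<comment> \<open>The indicator is 0 outside \<open>r\<close>, and \<open>computable_if\<close>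
    takes its first branch at 0, so the branches are passed in reverse order.\<close>
  from computable_if[OF this assms(5,4)] show ?thesis
    by (rule back_subst[of computable]) auto
qed

(* Self-reference: d is the index of a function whose parameter y contains a copy of d. *)
lemma ex_descending_family:
  assumes "computable_rel r"
  obtains f where
    "\<And>b a x. \<K>\<^sub>1 (f b a) x = Some (if (x, a) \<in> r \<and> (a, x) \<notin> r then f b x else 0)"
    "\<And>b b' a. f b a = f b' a \<Longrightarrow> b = b'"
    "computable (\<lambda>n. f (pfst n) (psnd n))"
proof -
  \<comment> \<open>Here \<open>y\<close> codes ((d, b), a): \<open>pfst (pfst y)\<close> is the
    copy of d, and \<open>prod_encode (pfst y, x)\<close> puts x in place of a. Being strictly below
    a is tested by two queries to \<open>r\<close>.\<close>
  let ?h = "\<lambda>y x. if (x, psnd y) \<in> r then if (psnd y, x) \<in> r then 0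
    else smn (pfst (pfst y)) (prod_encode (pfst y, x)) else 0"
  have "computable (\<lambda>n. ?h (pfst n) (psnd n))"
    by (intro computable_rel_if assms computable_smn computable_const computable_prod_encode
        computable_pfst computable_psnd computable_id)
  then obtain d where d: "\<And>y x. \<K>\<^sub>1 (smn d y) x = Some (?h y x)"
    using computable_index[of ?h] by (metis (no_types, lifting))
  define f where "f b a = smn d (prod_encode (prod_encode (d, b), a))" for b a
  show thesis
  proof
    show "\<K>\<^sub>1 (f b a) x = Some (if (x, a) \<in> r \<and> (a, x) \<notin> r then f b x else 0)" for b a x
      by (simp add: f_def d)
    show "b = b'" if "f b a = f b' a" for b b' a
      using inj_smn[OF that[unfolded f_def]] by (simp add: prod_encode_eq)
    show "computable (\<lambda>n. f (pfst n) (psnd n))"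
      unfolding f_def
      by (intro computable_smn computable_const computable_prod_encode
          computable_pfst computable_psnd computable_id)
  qed
qed

section \<open>Ranks\<close>

lemma ordinal_exhaust:
  obtains "\<alpha> = 0" | \<beta> where "\<alpha> = succ \<beta>" | "limit_ordinal \<alpha>"
  unfolding limit_ordinal_def by metis

lemma less_succ_iff: "\<alpha> < succ \<beta> \<longleftrightarrow> \<alpha> \<le> \<beta>"
  by (metis not_less succ_le_iff)

text \<open>The value of an application depends only on the values of its parts. This allows an
  application to be replaced by the element it evaluates to.\<close>

lemma sim_cong:
  assumes "val app s = val app s'" "val app t = val app t'"
  shows "sim app \<alpha> s t \<longleftrightarrow> sim app \<alpha> s' t'"
  using assms
proof (induction \<alpha> arbitrary: s t s' t' rule: less_induct)
  case (less \<alpha>)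
  show ?case
  proof (cases \<alpha> rule: ordinal_exhaust)
    case 1
    then show ?thesis using less.prems by (simp add: sim_0_iff)
  next
    case (2 \<beta>)
    have "sim app \<beta> (App s (Elem x)) (App t (Elem x)) \<longleftrightarrow>
        sim app \<beta> (App s' (Elem x)) (App t' (Elem x))" for x
      by (rule less.IH) (simp_all add: 2 less.prems less_succ)
    then show ?thesis by (simp add: 2 sim_succ_iff)
  next
    case 3
    have "sim app \<beta> s t \<longleftrightarrow> sim app \<beta> s' t'" if "\<beta> < \<alpha>" for \<beta>
      using that less.prems by (rule less.IH)
    then show ?thesis by (auto simp: sim_limit_iff[OF 3])
  qed
qed

lemma sim_refl: "val app s = val app t \<Longrightarrow> sim app \<alpha> s t"
  using sim_0 sim_mono zero_le_ordinal by blast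

text \<open>The first hypothesis excludes level 0, the second settles successors, and no new pair
  becomes related first at a limit. The rank is thus \<open>succ \<rho>\<close>.\<close>

lemma sim_iff_less:
  assumes "val app s \<noteq> val app t"
    and "\<And>\<delta>. (\<forall>x. sim app \<delta> (App s (Elem x)) (App t (Elem x))) \<longleftrightarrow> \<rho> \<le> \<delta>"
  shows "sim app \<gamma> s t \<longleftrightarrow> \<rho> < \<gamma>"
proof (induction \<gamma> rule: less_induct)
  case (less \<gamma>)
  show ?case
  proof (cases \<gamma> rule: ordinal_exhaust)
    case 1
    then show ?thesis using assms(1) zero_le_ordinal[of \<rho>] by (simp add: sim_0_iff not_less)
  next
    case (2 \<beta>)
    then show ?thesis using assms(2) by (simp add: sim_succ_iff less_succ_iff)
  next
    case 3
    \<comment> \<open>A limit above \<open>\<rho>\<close> is not \<open>succ \<rho>\<close>, which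
      therefore serves as the witness in the limit clause.\<close>
    have "succ \<rho> < \<gamma>" if "\<rho> < \<gamma>"
      using that 3 unfolding limit_ordinal_def by (metis order_le_less succ_le_iff)
    then have "(\<exists>\<delta><\<gamma>. \<rho> < \<delta>) \<longleftrightarrow> \<rho> < \<gamma>"
      using less_succ[of \<rho>] order_less_trans by blast
    moreover have "sim app \<gamma> s t \<longleftrightarrow> (\<exists>\<delta><\<gamma>. \<rho> < \<delta>)"
      unfolding sim_limit_iff[OF 3] using less by blast
    ultimately show ?thesis by simp
  qed
qed

section \<open>Order types of initial segments\<close>

definition position :: "nat rel \<Rightarrow> nat \<Rightarrow> ordinal" where
  "position r a = order_type (Restr r (underS r a))"

text \<open>The ordinals below an order type are exactly the positions of its elements. This makes
  it their least strict upper bound, the form that \<open>sim_iff_less\<close> consumes.\<close>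

lemma order_type_le_iff:
  assumes "Well_order r"
  shows "order_type r \<le> \<delta> \<longleftrightarrow> (\<forall>a\<in>Field r. position r a < \<delta>)"
proof
  assume "order_type r \<le> \<delta>"
  then show "\<forall>a\<in>Field r. position r a < \<delta>"
    using less_order_type_iff[OF assms] unfolding position_def by (blast intro: order_less_le_trans)
next
  assume *: "\<forall>a\<in>Field r. position r a < \<delta>"
  show "order_type r \<le> \<delta>"
  proof (rule ccontr)
    assume "\<not> order_type r \<le> \<delta>"
    then have "\<delta> < order_type r" by simp
    then show False
      using * unfolding less_order_type_iff[OF assms] position_def by blast
  qed
qed

text \<open>By transitivity an initial segment contains everything below its elements, so their
  positions in it and in \<open>r\<close> agree.\<close>

lemma position_le_iff:
  assumes r: "Well_order r"
  shows "position r a \<le> \<delta> \<longleftrightarrow> (\<forall>x\<in>underS r a. position r x < \<delta>)"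
proof -
  let ?q = "Restr r (underS r a)"
  have refl: "refl_on (Field r) r" and trans: "trans r" and anti: "antisym r"
    using r by (auto simp: well_order_on_def linear_order_on_def partial_order_on_def
        preorder_on_def)
  have sub: "underS r a \<subseteq> Field r" by (auto simp: underS_def Field_def)
  have F: "Field ?q = underS r a"
    using refl sub by (auto simp: Field_def refl_on_def)
  have "underS ?q x = underS r x" and "underS r x \<subseteq> underS r a" if "x \<in> underS r a" for x
    using that trans anti unfolding underS_def by (blast dest: transD antisymD)+
  then have "Restr ?q (underS ?q x) = Restr r (underS r x)" if "x \<in> underS r a" for x
    using that by blast
  then have "position ?q x = position r x" if "x \<in> underS r a" for x
    using that by (simp add: position_def)
  then show ?thesis
    using order_type_le_iff[OF Well_order_Restr[OF r]] F by (simp add: position_def[of r a])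
qed

section \<open>Separation at computable ordinals\<close>

lemma sim_succ_neq:
  assumes "computable_ordinal \<alpha>"
  shows "sim \<K>\<^sub>1 \<alpha> \<noteq> sim \<K>\<^sub>1 (succ \<alpha>)"
proof -
  obtain r where r: "Well_order r" "computable_rel r" "order_type r = \<alpha>"
    using assms computable_ordinal_def by blast
  have refl: "refl_on (Field r) r" and anti: "antisym r" and wf: "wf (r - Id)"
    using r(1) by (auto simp: well_order_on_def linear_order_on_def partial_order_on_def
        preorder_on_def)
  have strict: "(x, a) \<in> r \<and> (a, x) \<notin> r \<longleftrightarrow> x \<in> underS r a" for x a
    using refl anti by (auto simp: underS_def refl_on_def Field_def dest: antisymD)
  \<comment> \<open>Reflexivity turns membership in the field into a query to \<open>r\<close>,
    which makes the next function computable.\<close>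
  have field: "(x, x) \<in> r \<longleftrightarrow> x \<in> Field r" for x
    using refl by (auto simp: refl_on_def Field_def)
  obtain f where f: "\<And>b a x. \<K>\<^sub>1 (f b a) x =
        Some (if (x, a) \<in> r \<and> (a, x) \<notin> r then f b x else 0)"
      and f_inj: "\<And>b b' a. f b a = f b' a \<Longrightarrow> b = b'"
      and f_comp: "computable (\<lambda>n. f (pfst n) (psnd n))"
    using ex_descending_family[OF r(2)] by blast
  have "computable (\<lambda>n. if (psnd n, psnd n) \<in> r then f (pfst n) (psnd n) else 0)"
    by (intro computable_rel_if r f_comp computable_const computable_psnd computable_id)
  then obtain e where e: "\<And>b x. \<K>\<^sub>1 (smn e b) x = Some (if (x, x) \<in> r then f b x else 0)"
    using computable_index[of "\<lambda>b x. if (x, x) \<in> r then f b x else 0"] by blast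
  \<comment> \<open>Outside \<open>A\<close> both functions return 0, so these arguments are related
    at every level and impose no condition.\<close>
  have step: "(\<forall>x. sim \<K>\<^sub>1 \<delta> (App (Elem s) (Elem x)) (App (Elem t) (Elem x))) \<longleftrightarrow>
      (\<forall>x\<in>A. sim \<K>\<^sub>1 \<delta> (Elem (f 0 x)) (Elem (f 1 x)))"
    if "\<And>x. \<K>\<^sub>1 s x = Some (if x \<in> A then f 0 x else 0)"
      and "\<And>x. \<K>\<^sub>1 t x = Some (if x \<in> A then f 1 x else 0)" for s t A \<delta>
  proof -
    have "sim \<K>\<^sub>1 \<delta> (App (Elem s) (Elem x)) (App (Elem t) (Elem x)) \<longleftrightarrow>
        (x \<in> A \<longrightarrow> sim \<K>\<^sub>1 \<delta> (Elem (f 0 x)) (Elem (f 1 x)))" for x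
    proof (cases "x \<in> A")
      case True
      then have "sim \<K>\<^sub>1 \<delta> (App (Elem s) (Elem x)) (App (Elem t) (Elem x)) \<longleftrightarrow>
          sim \<K>\<^sub>1 \<delta> (Elem (f 0 x)) (Elem (f 1 x))"
        by (intro sim_cong) (simp_all add: that)
      then show ?thesis using True by simp
    next
      case False
      then show ?thesis by (simp add: that sim_refl)
    qed
    then show ?thesis by blast
  qed
  \<comment> \<open>This covers \<open>a\<close> outside the field too: nothing is below it, so its
    position is 0 and both functions are constantly 0.\<close>
  have rank: "sim \<K>\<^sub>1 \<gamma> (Elem (f 0 a)) (Elem (f 1 a)) \<longleftrightarrow> position r a < \<gamma>" for a \<gamma>
    using wf
  proof (induction a arbitrary: \<gamma> rule: wf_induct_rule)
    case (less a)
    have "sim \<K>\<^sub>1 \<delta> (Elem (f 0 x)) (Elem (f 1 x)) \<longleftrightarrow> position r x < \<delta>"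
      if "x \<in> underS r a" for x \<delta>
      using that less by (auto simp: underS_def)
    then have "(\<forall>x. sim \<K>\<^sub>1 \<delta> (App (Elem (f 0 a)) (Elem x)) (App (Elem (f 1 a)) (Elem x))) \<longleftrightarrow>
        position r a \<le> \<delta>" for \<delta>
      by (simp add: step[of "f 0 a" "underS r a" "f 1 a"] f strict position_le_iff[OF r(1)]
          del: One_nat_def)
    \<comment> \<open>Both functions are constantly 0 when nothing is below \<open>a\<close>;
      distinct indices still keep the pair unrelated at level 0.\<close>
    moreover have "f 0 a \<noteq> f 1 a" using f_inj[of 0 a 1] by auto
    ultimately show ?case by (intro sim_iff_less) simp_all
  qed
  \<comment> \<open>The two indices act like an extra element on top of \<open>r\<close>: the
    elements below it are the whole field, so its position would be \<open>\<alpha>\<close>.\<close>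
  have "(\<forall>x. sim \<K>\<^sub>1 \<delta> (App (Elem (smn e 0)) (Elem x)) (App (Elem (smn e 1)) (Elem x))) \<longleftrightarrow>
      \<alpha> \<le> \<delta>" for \<delta>
    by (simp add: step[of "smn e 0" "Field r" "smn e 1"] e field rank
        order_type_le_iff[OF r(1)] del: One_nat_def flip: r(3))
  moreover have "smn e 0 \<noteq> smn e 1" using inj_smn[of e 0 e 1] by auto
  ultimately have "sim \<K>\<^sub>1 \<gamma> (Elem (smn e 0)) (Elem (smn e 1)) \<longleftrightarrow> \<alpha> < \<gamma>" for \<gamma>
    by (intro sim_iff_less) simp_all
  then show ?thesis using less_succ[of \<alpha>] by (metis order_less_irrefl)
qed

theorem theorem5p1:
  shows "inj_on (sim \<K>\<^sub>1) {\<alpha>. \<alpha> \<le> \<omega>\<^sub>1_CK} \<and> \<omega>\<^sub>1_CK \<le> pca_ord \<K>\<^sub>1"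
proof
  have neq: "sim \<K>\<^sub>1 \<alpha> \<noteq> sim \<K>\<^sub>1 (succ \<alpha>)" if "\<alpha> < \<omega>\<^sub>1_CK" for \<alpha>
    using that not_less_Least sim_succ_neq unfolding \<omega>\<^sub>1_CK_def by blast
  show "inj_on (sim \<K>\<^sub>1) {\<alpha>. \<alpha> \<le> \<omega>\<^sub>1_CK}"
  proof (rule linorder_inj_onI)
    fix \<alpha> \<beta> assume less: "\<alpha> < \<beta>" and "\<alpha> \<in> {\<alpha>. \<alpha> \<le> \<omega>\<^sub>1_CK}" "\<beta> \<in> {\<alpha>. \<alpha> \<le> \<omega>\<^sub>1_CK}"
    then have "\<alpha> < \<omega>\<^sub>1_CK" by auto
    \<comment> \<open>The relations grow with the ordinal, so if those at \<open>\<alpha>\<close>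
      and \<open>\<beta>\<close> were equal, the one at \<open>succ \<alpha>\<close> would be
      squeezed between them.\<close>
    moreover have "sim \<K>\<^sub>1 \<alpha> \<le> sim \<K>\<^sub>1 (succ \<alpha>)" "sim \<K>\<^sub>1 (succ \<alpha>) \<le> sim \<K>\<^sub>1 \<beta>"
      using less sim_imp_sim_succ sim_mono succ_le_iff by blast+
    ultimately show "sim \<K>\<^sub>1 \<alpha> \<noteq> sim \<K>\<^sub>1 \<beta>"
      using neq by (metis order_antisym)
  qed auto
  \<comment> \<open>The least stabilizing ordinal is attained, and \<open>neq\<close> excludes
    stabilization below \<open>\<omega>\<^sub>1_CK\<close>.\<close>
  have "sim \<K>\<^sub>1 (pca_ord \<K>\<^sub>1) = sim \<K>\<^sub>1 (succ (pca_ord \<K>\<^sub>1))"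
    unfolding pca_ord_def using ex_sim_succ_eq by (rule LeastI_ex)
  then show "\<omega>\<^sub>1_CK \<le> pca_ord \<K>\<^sub>1" using neq not_less by blast
qed

end
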